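(* Let $F$ be a field, $\lambda\ge 0$ an integer, and $A_1,\dots,A_n$ $\lambda$-null finite subsets of $F$ with $|A_i|>1$ for each $i$. If $f\in F[X_1,\dots,X_n]$ has $\deg(f)\le\lambda$, then \[f=\sum_{k_1+\dots+k_n\leq\lambda}\Bigg(\sum_{a\in A_1\times\dots\times A_n}a_1^{|A_1|-k_1-1}\cdots a_n^{|A_n|-k_n-1}\,w_a\,f(a)\Bigg)X_1^{k_1}\cdots X_n^{k_n},\] where the outer sum runs over tuples of non-negative integers $(k_1,\dots,k_n)$ and $a=(a_1,\dots,a_n)$.
   Context: For a finite non-empty $A\subseteq F$, $\Pi_A(X)=\prod_{a\in A}(X-a)$; $A$ is $\lambda$-null (for $\lambda\in\{0,\dots,|A|\}$) if in $\Pi_A(X)$ the coefficients of $X^{|A|-1},\dots,X^{|A|-\lambda}$ vanish. For $a=(a_1,\dots,a_n)$ in the grid, $w_a=\frac{1}{\Pi'_{A_1}(a_1)\cdots\Pi'_{A_n}(a_n)}$, with $\Pi'_A(a)=\prod_{b\in A,\,b\ne a}(a-b)$. Here $0^0=1$. $\deg(f)$ is the total degree. *)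

theory Defs
  imports "HOL-Library.Poly_Mapping" "HOL-Library.FuncSet"
    "HOL-Computational_Algebra.Polynomial"
begin

text \<open>
  A monomial $X_1^{k_1} X_2^{k_2} \cdots$ is its exponent vector, a finitely supported
  function \<open>k :: nat \<Rightarrow>\<^sub>0 nat\<close>; a polynomial maps monomials to coefficients. The ring
  operations on \<open>'a mvpoly\<close> (convolution product) are those of \<open>Poly_Mapping\<close>, and
  \<open>Poly_Mapping.single k c\<close> is the term $c X^k$.
\<close>

type_synonym 'a mvpoly = "(nat \<Rightarrow>\<^sub>0 nat) \<Rightarrow>\<^sub>0 'a"

text \<open>The polynomials in the variables $X_1, \dots, X_n$ only, i.e. $F[X_1,\dots,X_n]$.\<close>

definition polys_in :: "nat \<Rightarrow> 'a::zero mvpoly set" where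
  "polys_in n = {f. \<forall>m \<in> Poly_Mapping.keys f. Poly_Mapping.keys m \<subseteq> {1..n}}"

text \<open>The zero polynomial gets total degree \<open>0\<close>; this makes no difference in bounds
  of the form $\deg f \le d$ with \<open>d :: nat\<close>.\<close>

definition total_deg :: "'a::zero mvpoly \<Rightarrow> nat" where
  "total_deg f = Max (insert 0
     ((\<lambda>m. \<Sum>i \<in> Poly_Mapping.keys m. Poly_Mapping.lookup m i) ` Poly_Mapping.keys f))"

definition eval_poly :: "'a::comm_semiring_1 mvpoly \<Rightarrow> (nat \<Rightarrow> 'a) \<Rightarrow> 'a" where
  "eval_poly f x = (\<Sum>m \<in> Poly_Mapping.keys f. Poly_Mapping.lookup f m *
     (\<Prod>i \<in> Poly_Mapping.keys m. x i ^ Poly_Mapping.lookup m i))"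

definition Pi_poly :: "'a::field set \<Rightarrow> 'a poly" where
  "Pi_poly A = (\<Prod>a\<in>A. [:- a, 1:])"

definition null_set :: "nat \<Rightarrow> 'a::field set \<Rightarrow> bool" where
  "null_set l A \<longleftrightarrow> finite A \<and> A \<noteq> {} \<and> l \<le> card A \<and>
     (\<forall>j \<in> {1..l}. poly.coeff (Pi_poly A) (card A - j) = 0)"

definition Pi_deriv :: "'a::field set \<Rightarrow> 'a \<Rightarrow> 'a" where
  "Pi_deriv A a = (\<Prod>b \<in> A - {a}. a - b)"

definition weight :: "nat \<Rightarrow> (nat \<Rightarrow> 'a::field set) \<Rightarrow> (nat \<Rightarrow> 'a) \<Rightarrow> 'a" where
  "weight n A a = 1 / (\<Prod>i = 1..n. Pi_deriv (A i) (a i))"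

definition exponents :: "nat \<Rightarrow> nat \<Rightarrow> (nat \<Rightarrow>\<^sub>0 nat) set" where
  "exponents n d = {k. Poly_Mapping.keys k \<subseteq> {1..n} \<and>
     (\<Sum>i = 1..n. Poly_Mapping.lookup k i) \<le> d}"

text \<open>A sum over \<open>exponents n d\<close> is a genuine finite sum.\<close>

lemma finite_exponents: "finite (exponents n d)"
proof (rule finite_imageD)
  let ?g = "\<lambda>k. restrict (Poly_Mapping.lookup k) {1..n}"
  have "?g ` exponents n d \<subseteq> PiE {1..n} (\<lambda>_. {..d})"
  proof (intro image_subsetI restrict_PiE_iff[THEN iffD2] ballI)
    fix k i assume k: "k \<in> exponents n d" and i: "i \<in> {1..n}"
    have "Poly_Mapping.lookup k i \<le> (\<Sum>i = 1..n. Poly_Mapping.lookup k i)"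
      using i by (intro member_le_sum) auto
    then show "Poly_Mapping.lookup k i \<in> {..d}"
      using k by (simp add: exponents_def)
  qed
  then show "finite (?g ` exponents n d)"
    by (rule finite_subset) (intro finite_PiE; simp)
  show "inj_on ?g (exponents n d)"
  proof (rule inj_onI, rule poly_mapping_eqI)
    fix k k' i
    assume *: "k \<in> exponents n d" "k' \<in> exponents n d" "?g k = ?g k'"
    show "Poly_Mapping.lookup k i = Poly_Mapping.lookup k' i"
    proof (cases "i \<in> {1..n}")
      case True
      then show ?thesis using fun_cong[OF *(3), of i] by simp
    next
      case False
      then have "i \<notin> Poly_Mapping.keys k" "i \<notin> Poly_Mapping.keys k'"
        using *(1,2) unfolding exponents_def by blast+
      then show ?thesis by (simp add: in_keys_iff)
    qed
  qed
qed

end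

theory Submission imports Defs begin

text \<open>
  Comparing leading coefficients in Lagrange interpolation shows that the sum of
  $a^j / \Pi'_A(a)$ over $a \in A$ is $0$ for $j < |A| - 1$ and $1$ for $j = |A| - 1$. If $A$ is
  $\lambda$-null, then $a^{|A|}$ is a combination of the powers $a^i$ with $i < |A| - \lambda$, so
  the sum vanishes also for $|A| \le j \le |A| - 1 + \lambda$. On a grid these sums multiply, and
  they single out the coefficient of $X^k$ in each polynomial of degree at most $\lambda$.
\<close>

text \<open>Since \<open>degree p < card A\<close>, \<open>p\<close> is its own Lagrange interpolant
  on \<open>A\<close>. Each \<open>?L a\<close> is monic of degree \<open>card A - 1\<close>, so the
  coefficient there is the sum of the interpolation weights; it may be zero.\<close>

lemma coeff_eq_sum_Pi_deriv:
  fixes A :: "'a::field set"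
  assumes "finite A" and deg: "degree p < card A"
  shows "poly.coeff p (card A - 1) = (\<Sum>a\<in>A. poly p a / Pi_deriv A a)"
proof -
  let ?L = "\<lambda>a. \<Prod>b\<in>A - {a}. [:- b, 1:]"
  let ?q = "\<Sum>a\<in>A. smult (poly p a / Pi_deriv A a) (?L a)"
  have deg_L: "degree (?L a) = card A - 1" if "a \<in> A" for a
    using that assms(1) by (subst degree_prod_sum_eq) auto
  have lead_L: "poly.coeff (?L a) (card A - 1) = 1" if "a \<in> A" for a
    using lead_coeff_prod[of "\<lambda>b. [:- b, 1:]" "A - {a}"] deg_L[OF that] by simp
  have "p = ?q"
  proof (rule poly_eqI_degree)
    fix x assume x: "x \<in> A"
    have "poly (?L a) x = (if a = x then Pi_deriv A x else 0)" if "a \<in> A" for a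
      using x assms(1) by (auto simp: poly_prod Pi_deriv_def)
    then have "poly ?q x = (\<Sum>a\<in>A. if a = x then poly p x / Pi_deriv A x * Pi_deriv A x else 0)"
      unfolding poly_sum by (intro sum.cong) auto
    \<comment> \<open>The quotient cancels because \<open>Pi_deriv A x\<close> is a product of
      nonzero differences.\<close>
    also have "\<dots> = poly p x"
      using x assms(1) by (simp add: Pi_deriv_def)
    finally show "poly p x = poly ?q x" by simp
  next
    have "degree ?q \<le> card A - 1"
      using assms(1) deg_L by (intro degree_sum_le) (auto intro: order.trans[OF degree_smult_le])
    then show "degree ?q < card A" using deg by simp
  qed (rule deg)
  then have "poly.coeff p (card A - 1) = poly.coeff ?q (card A - 1)" by simp
  also have "\<dots> = (\<Sum>a\<in>A. poly p a / Pi_deriv A a)"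
    unfolding coeff_sum using lead_L by (intro sum.cong refl) simp
  finally show ?thesis .
qed

lemma sum_power_Pi_deriv:
  fixes A :: "'a::field set"
  assumes "finite A" and "j < card A"
  shows "(\<Sum>a\<in>A. a ^ j / Pi_deriv A a) = (if j = card A - 1 then 1 else 0)"
  using coeff_eq_sum_Pi_deriv[of A "monom 1 j"] assms
  by (simp add: degree_monom_eq poly_monom)

text \<open>Every \<open>a\<close> in \<open>A\<close> is a root of the monic polynomial
  \<open>Pi_poly A\<close>, and nullity removes its \<open>l\<close> coefficients just below the
  leading one.\<close>

lemma null_set_power_card:
  assumes "null_set l A" and "a \<in> A"
  shows "a ^ card A = - (\<Sum>i<card A - l. poly.coeff (Pi_poly A) i * a ^ i)"
proof -
  let ?c = "poly.coeff (Pi_poly A)"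
  have fin: "finite A" and null: "\<And>j. j \<in> {1..l} \<Longrightarrow> ?c (card A - j) = 0"
    using assms(1) by (auto simp: null_set_def)
  have deg: "degree (Pi_poly A) = card A"
    unfolding Pi_poly_def by (subst degree_prod_sum_eq) auto
  have lead: "?c (card A) = 1"
    using lead_coeff_prod[of "\<lambda>b. [:- b, 1:]" A] deg by (simp add: Pi_poly_def)
  have zero: "?c i = 0" if "i < card A" "card A - l \<le> i" for i
    using null[of "card A - i"] that by force
  have "0 = poly (Pi_poly A) a"
    using assms(2) fin by (auto simp: Pi_poly_def poly_prod)
  also have "\<dots> = (\<Sum>i<card A. ?c i * a ^ i) + a ^ card A"
    by (simp add: poly_altdef deg lead flip: lessThan_Suc_atMost)
  also have "(\<Sum>i<card A. ?c i * a ^ i) = (\<Sum>i<card A - l. ?c i * a ^ i)"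
    by (rule sum.mono_neutral_right) (auto simp: zero)
  finally show ?thesis by (simp add: eq_neg_iff_add_eq_0 add.commute)
qed

text \<open>If \<open>l\<close> reached \<open>card A\<close>, the sum in
  \<open>null_set_power_card\<close> would be empty, so every element of \<open>A\<close> would be
  nilpotent, hence zero. The strict bound later ensures that the exponents
  \<open>card (A i) - k i - 1\<close> are not truncated.\<close>

lemma null_set_less_card:
  assumes "null_set l A" and "card A > 1"
  shows "l < card A"
proof (rule ccontr)
  assume "\<not> l < card A"
  then have "a = 0" if "a \<in> A" for a
    using null_set_power_card[OF assms(1) that] by simp
  then have "A \<subseteq> {0}" by auto
  then have "card A \<le> card {0 :: 'a}" by (intro card_mono) auto
  with assms(2) show False by simp
qed

lemma null_set_sum_power:
  assumes "null_set l A" and "j < card A + l"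
  shows "(\<Sum>a\<in>A. a ^ j / Pi_deriv A a) = (if j = card A - 1 then 1 else 0)"
proof (cases "j < card A")
  case True
  with assms(1) show ?thesis by (intro sum_power_Pi_deriv) (auto simp: null_set_def)
next
  case False
  let ?c = "poly.coeff (Pi_poly A)"
  have fin: "finite A" and pos: "card A > 0" and le: "l \<le> card A"
    using assms(1) by (auto simp: null_set_def card_gt_0_iff)
  define t where "t = j - card A"
  have j: "j = card A + t" and t: "t < l" using False assms(2) by (auto simp: t_def)
  have "(\<Sum>a\<in>A. a ^ j / Pi_deriv A a) =
      (\<Sum>a\<in>A. \<Sum>i<card A - l. - ?c i * (a ^ (i + t) / Pi_deriv A a))"
    by (intro sum.cong refl)
       (simp add: j power_add null_set_power_card[OF assms(1)] sum_distrib_right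
          sum_divide_distrib sum_negf mult.assoc)
  also have "\<dots> = (\<Sum>i<card A - l. - ?c i * (\<Sum>a\<in>A. a ^ (i + t) / Pi_deriv A a))"
    by (subst sum.swap) (simp add: sum_distrib_left)
  \<comment> \<open>From \<open>i < card A - l\<close> and \<open>t < l\<close> follows
    \<open>i + t \<le> card A - 2\<close>, strictly below the one exponent with a nonzero
    sum.\<close>
  also have "\<dots> = 0"
    using t le by (intro sum.neutral ballI) (simp add: sum_power_Pi_deriv[OF fin])
  finally show ?thesis using False pos by simp
qed

lemma exponents_0_outside:
  assumes "k \<in> exponents n l" and "i \<notin> {1..n}"
  shows "Poly_Mapping.lookup k i = 0"
  using assms by (auto simp: exponents_def in_keys_iff)

lemma keys_subset_exponents:
  assumes "f \<in> polys_in n" and "total_deg f \<le> l"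
  shows "Poly_Mapping.keys f \<subseteq> exponents n l"
proof
  fix m assume m: "m \<in> Poly_Mapping.keys f"
  have keys: "Poly_Mapping.keys m \<subseteq> {1..n}"
    using assms(1) m by (auto simp: polys_in_def)
  have "(\<Sum>i=1..n. Poly_Mapping.lookup m i) = (\<Sum>i\<in>Poly_Mapping.keys m. Poly_Mapping.lookup m i)"
    using keys by (intro sum.mono_neutral_right) (auto simp: in_keys_iff)
  also have "\<dots> \<le> total_deg f"
    unfolding total_deg_def using m by (intro Max_ge) auto
  finally show "m \<in> exponents n l"
    using assms(2) keys by (simp add: exponents_def)
qed

text \<open>The summand is a product over coordinates, so the grid sum is a product of one-variable
  sums, each testing whether \<open>m\<close> and \<open>k\<close> agree at one index. The
  functionals on the left are thus dual to the monomials of degree at most \<open>l\<close>.\<close>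

lemma grid_sum_monomial:
  fixes A :: "nat \<Rightarrow> 'a::field set"
  assumes null: "\<And>i. i \<in> {1..n} \<Longrightarrow> null_set l (A i)"
    and card: "\<And>i. i \<in> {1..n} \<Longrightarrow> card (A i) > 1"
    and k: "k \<in> exponents n l" and m: "m \<in> exponents n l"
  shows "(\<Sum>a \<in> PiE {1..n} A.
      (\<Prod>i = 1..n. a i ^ (card (A i) - Poly_Mapping.lookup k i - 1)) * weight n A a *
      (\<Prod>i \<in> Poly_Mapping.keys m. a i ^ Poly_Mapping.lookup m i)) = (if m = k then 1 else 0)"
proof -
  let ?k = "Poly_Mapping.lookup k" and ?m = "Poly_Mapping.lookup m"
  have le: "?k i \<le> l" "?m i \<le> l" if "i \<in> {1..n}" for i
    using member_le_sum[OF that, of ?k] member_le_sum[OF that, of ?m] k m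
    by (auto simp: exponents_def)
  have "(\<Prod>i = 1..n. a i ^ (card (A i) - ?k i - 1)) * weight n A a *
      (\<Prod>i \<in> Poly_Mapping.keys m. a i ^ ?m i) =
      (\<Prod>i = 1..n. a i ^ (card (A i) - ?k i - 1 + ?m i) / Pi_deriv (A i) (a i))" for a
  proof -
    have "(\<Prod>i \<in> Poly_Mapping.keys m. a i ^ ?m i) = (\<Prod>i = 1..n. a i ^ ?m i)"
      using m by (intro prod.mono_neutral_left) (auto simp: exponents_def in_keys_iff)
    then show ?thesis
      by (simp add: weight_def power_add prod.distrib prod_dividef)
  qed
  then have "(\<Sum>a \<in> PiE {1..n} A.
      (\<Prod>i = 1..n. a i ^ (card (A i) - ?k i - 1)) * weight n A a *
      (\<Prod>i \<in> Poly_Mapping.keys m. a i ^ ?m i)) =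
      (\<Prod>i = 1..n. \<Sum>a\<in>A i. a ^ (card (A i) - ?k i - 1 + ?m i) / Pi_deriv (A i) a)"
    using null by (subst prod_sum_PiE) (auto simp: null_set_def)
  also have "\<dots> = (\<Prod>i = 1..n. if ?m i = ?k i then 1 else 0)"
  proof (intro prod.cong refl)
    fix i assume i: "i \<in> {1..n}"
    note bounds = null_set_less_card[OF null card, OF i i] le[OF i]
    have "card (A i) - ?k i - 1 + ?m i < card (A i) + l"
      using bounds by simp
    from null_set_sum_power[OF null[OF i] this]
    show "(\<Sum>a\<in>A i. a ^ (card (A i) - ?k i - 1 + ?m i) / Pi_deriv (A i) a) =
        (if ?m i = ?k i then 1 else 0)"
      \<comment> \<open>As \<open>k i \<le> l < card (A i)\<close>, the subtraction is exact, and
        the exponent equals \<open>card (A i) - 1\<close> only for equal entries of \<open>m\<close>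
        and \<open>k\<close>.\<close>
      using bounds by auto
  qed
  also have "\<dots> = (if m = k then 1 else 0)"
  proof (cases "m = k")
    case False
    \<comment> \<open>Both exponent vectors vanish outside \<open>{1..n}\<close>, so a differing
      index contributes a zero factor.\<close>
    then obtain i where i: "?m i \<noteq> ?k i" by (auto simp: poly_mapping_eq_iff fun_eq_iff)
    with k m have "i \<in> {1..n}" by (metis exponents_0_outside)
    with i False show ?thesis by (auto intro!: prod_zero)
  qed simp
  finally show ?thesis .
qed

theorem theorem6p9:
  fixes n l :: nat
    and A :: "nat \<Rightarrow> 'a::field set"
    and f :: "'a mvpoly"
  assumes "\<And>i. i \<in> {1..n} \<Longrightarrow> null_set l (A i)"
    and "\<And>i. i \<in> {1..n} \<Longrightarrow> card (A i) > 1"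
    and "f \<in> polys_in n"
    and "total_deg f \<le> l"
  shows "f = (\<Sum>k \<in> exponents n l.
           Poly_Mapping.single k
             (\<Sum>a \<in> PiE {1..n} A.
                (\<Prod>i = 1..n. a i ^ (card (A i) - Poly_Mapping.lookup k i - 1)) *
                weight n A a * eval_poly f a))"
    (is "f = (\<Sum>k \<in> _. Poly_Mapping.single k (?C k))")
proof (rule poly_mapping_eqI)
  fix k
  let ?f = "Poly_Mapping.lookup f"
  let ?w = "\<lambda>k a. (\<Prod>i = 1..n. a i ^ (card (A i) - Poly_Mapping.lookup k i - 1)) * weight n A a"
  note sub = keys_subset_exponents[OF assms(3,4)]
  have coeff: "?C k = ?f k" if k: "k \<in> exponents n l" for k
  proof -
    \<comment> \<open>\<open>?C k\<close> is linear in \<open>f\<close>, which reduces the claim to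
      single monomials.\<close>
    have "?C k = (\<Sum>m \<in> Poly_Mapping.keys f. ?f m * (\<Sum>a \<in> PiE {1..n} A.
        ?w k a * (\<Prod>i \<in> Poly_Mapping.keys m. a i ^ Poly_Mapping.lookup m i)))"
      unfolding eval_poly_def sum_distrib_left by (subst sum.swap) (simp add: ac_simps)
    also have "\<dots> = (\<Sum>m \<in> Poly_Mapping.keys f. if m = k then ?f k else 0)"
    proof (intro sum.cong refl)
      fix m assume "m \<in> Poly_Mapping.keys f"
      with sub have "m \<in> exponents n l" by auto
      then show "?f m * (\<Sum>a \<in> PiE {1..n} A.
          ?w k a * (\<Prod>i \<in> Poly_Mapping.keys m. a i ^ Poly_Mapping.lookup m i)) =
          (if m = k then ?f k else 0)"
        by (subst grid_sum_monomial[OF assms(1,2) k]) auto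
    qed
    also have "\<dots> = ?f k" by (simp add: in_keys_iff)
    finally show ?thesis .
  qed
  have "Poly_Mapping.lookup (\<Sum>k \<in> exponents n l. Poly_Mapping.single k (?C k)) k =
      (\<Sum>k' \<in> exponents n l. if k' = k then ?C k else 0)"
    unfolding lookup_sum by (intro sum.cong refl) (simp add: lookup_single when_def)
  \<comment> \<open>For \<open>k\<close> outside \<open>exponents n l\<close> both sides are zero,
    since by \<open>sub\<close> such a \<open>k\<close> is not a key of \<open>f\<close>.\<close>
  also have "\<dots> = ?f k"
    using sub coeff[of k] by (auto simp: finite_exponents in_keys_iff)
  finally show "?f k =
      Poly_Mapping.lookup (\<Sum>k \<in> exponents n l. Poly_Mapping.single k (?C k)) k" ..
qed

end
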